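(* There exists an absolute constant $A<\infty$ such that $C_s(Q)\le A\,Q^2$ for every $Q\ge1$; that is, for every weight $w$ on $\mathbb{R}$ with $[w]_{A_2}\le Q$, every $J\in\mathcal{D}$ and every measurable $\varphi$ with $\int_J\varphi^2w^{-1}\,dx<\infty$, $$\frac{1}{|J|}\sum_{I\in\mathcal{D}(J)}|\Delta_I(\varphi w^{-1})|^2\,\langle w\rangle_I\,|I|\le A\,Q^2\,\langle\varphi^2w^{-1}\rangle_J .$$ Moreover this estimate is sharp in its order of growth: there is an absolute constant $c>0$ such that $C_s(Q)\ge c\,Q^2$ for all sufficiently large $Q$.
   Context: $\mathcal{D}$ is the family of standard dyadic intervals of $\mathbb{R}$, and for $J\in\mathcal{D}$, $\mathcal{D}(J)$ is the family of all $I\in\mathcal{D}$ with $I\subset J$ (including $J$). For $I\in\mathcal{D}$, $I_+$ and $I_-$ are its two dyadic children (halves), and $\langle f\rangle_I=\frac1{|I|}\int_I f\,dx$. The martingale difference is $\Delta_I f=\frac12\big[(\langle f\rangle_{I_+}-\langle f\rangle_{I_-})\mathbf 1_{I_+}+(\langle f\rangle_{I_-}-\langle f\rangle_{I_+})\mathbf 1_{I_-}\big]$, so $|\Delta_I f|$ is constant on $I$ and is identified with the number $\frac12|\langle f\rangle_{I_+}-\langle f\rangle_{I_-}|$. A weight is a positive locally integrable function $w$ with $w^{-1}$ locally integrable, and (dyadic $A_2$) $[w]_{A_2}=\sup_{J\in\mathcal{D}}\langle w\rangle_J\langle w^{-1}\rangle_J$. $C_s(Q)$ denotes the smallest constant $C$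 such that $\frac{1}{|J|}\sum_{I\in\mathcal{D}(J)}|\Delta_I(\varphi w^{-1})|^2\langle w\rangle_I|I|\le C\langle\varphi^2w^{-1}\rangle_J$ for all weights $w$ with $[w]_{A_2}\le Q$, all $J\in\mathcal{D}$ and all measurable $\varphi$ with $\int_J\varphi^2w^{-1}\,dx<\infty$. *)

theory Defs
  imports "HOL-Analysis.Analysis"
begin

definition dyadic_interval :: "int \<Rightarrow> int \<Rightarrow> real set" where
  "dyadic_interval n k = {of_int k * 2 powi n ..< (of_int k + 1) * 2 powi n}"

definition dyadic_intervals :: "real set set" where
  "dyadic_intervals = {dyadic_interval n k | n k. True}"

definition dyadic_subintervals :: "real set \<Rightarrow> real set set" where
  "dyadic_subintervals J = {I \<in> dyadic_intervals. I \<subseteq> J}"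

text \<open>The halves are meaningful for bounded intervals; for dyadic intervals they are the two
  dyadic children, see \<open>halves_dyadic\<close> below.\<close>

definition midpt :: "real set \<Rightarrow> real" where
  "midpt I = (Inf I + Sup I) / 2"

definition left_half :: "real set \<Rightarrow> real set" where
  "left_half I = {x \<in> I. x < midpt I}"

definition right_half :: "real set \<Rightarrow> real set" where
  "right_half I = {x \<in> I. midpt I \<le> x}"

lemma halves_dyadic:
  "left_half (dyadic_interval n k) = dyadic_interval (n - 1) (2 * k)"
  "right_half (dyadic_interval n k) = dyadic_interval (n - 1) (2 * k + 1)"
proof -
  define h :: real where "h = 2 powi (n - 1)"
  have h: "h > 0" "2 powi n = 2 * h"
    by (simp_all add: h_def power_int_diff)
  have m: "midpt (dyadic_interval n k) = (2 * of_int k + 1) * h"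
    using h by (simp add: midpt_def dyadic_interval_def algebra_simps)
  show "left_half (dyadic_interval n k) = dyadic_interval (n - 1) (2 * k)"
    unfolding left_half_def m using h by (auto simp: dyadic_interval_def h_def[symmetric] algebra_simps)
  show "right_half (dyadic_interval n k) = dyadic_interval (n - 1) (2 * k + 1)"
    unfolding right_half_def m using h by (auto simp: dyadic_interval_def h_def[symmetric] algebra_simps)
qed

definition avg :: "(real \<Rightarrow> real) \<Rightarrow> real set \<Rightarrow> real" where
  "avg f I = (1 / measure lebesgue I) * (LINT x:I|lebesgue. f x)"

definition mart_diff :: "real set \<Rightarrow> (real \<Rightarrow> real) \<Rightarrow> real \<Rightarrow> real" where
  "mart_diff I f x = 1 / 2 *
     ((avg f (right_half I) - avg f (left_half I)) * indicator (right_half I) x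
    + (avg f (left_half I) - avg f (right_half I)) * indicator (left_half I) x)"

text \<open>The constant value of \<open>\<bar>mart_diff I f\<bar>\<close> on \<open>I\<close>.\<close>

definition abs_mart_diff :: "real set \<Rightarrow> (real \<Rightarrow> real) \<Rightarrow> real" where
  "abs_mart_diff I f = 1 / 2 * \<bar>avg f (right_half I) - avg f (left_half I)\<bar>"

lemma abs_mart_diff_eq:
  assumes "x \<in> I"
  shows "\<bar>mart_diff I f x\<bar> = abs_mart_diff I f"
  using assms
  by (auto simp: mart_diff_def abs_mart_diff_def left_half_def right_half_def indicator_def)

definition locally_integrable :: "(real \<Rightarrow> real) \<Rightarrow> bool" where
  "locally_integrable f \<longleftrightarrow> (\<forall>K. compact K \<longrightarrow> set_integrable lebesgue K f)"

definition weight :: "(real \<Rightarrow> real) \<Rightarrow> bool" where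
  "weight w \<longleftrightarrow> (\<forall>x. 0 < w x) \<and> locally_integrable w \<and> locally_integrable (\<lambda>x. inverse (w x))"

definition A2_char :: "(real \<Rightarrow> real) \<Rightarrow> ennreal" where
  "A2_char w = (SUP J\<in>dyadic_intervals. ennreal (avg w J * avg (\<lambda>x. inverse (w x)) J))"

definition square_sum :: "(real \<Rightarrow> real) \<Rightarrow> (real \<Rightarrow> real) \<Rightarrow> real set \<Rightarrow> ennreal" where
  "square_sum w \<phi> J = ennreal (1 / measure lebesgue J) *
     (\<Sum>\<^sub>\<infinity>I\<in>dyadic_subintervals J. ennreal
        ((abs_mart_diff I (\<lambda>x. \<phi> x * inverse (w x)))\<^sup>2 * avg w I * measure lebesgue I))"

definition admissible :: "real \<Rightarrow> (real \<Rightarrow> real) \<Rightarrow> real set \<Rightarrow> (real \<Rightarrow> real) \<Rightarrow> bool" where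
  "admissible Q w J \<phi> \<longleftrightarrow> weight w \<and> A2_char w \<le> ennreal Q \<and> J \<in> dyadic_intervals \<and>
     \<phi> \<in> borel_measurable lebesgue \<and>
     set_integrable lebesgue J (\<lambda>x. (\<phi> x)\<^sup>2 * inverse (w x))"

text \<open>The smallest constant, with value \<open>\<infinity>\<close> if no finite constant works.  The infimum is a minimum
  because the condition on \<open>C\<close> is a family of non-strict linear inequalities.\<close>

definition C_s :: "real \<Rightarrow> ennreal" where
  "C_s Q = Inf {C. \<forall>w J \<phi>. admissible Q w J \<phi> \<longrightarrow>
     square_sum w \<phi> J \<le> C * ennreal (avg (\<lambda>x. (\<phi> x)\<^sup>2 * inverse (w x)) J)}"

end

theory Submission
  imports Defs
begin

text \<open>
  Upper bound. With \<open>\<sigma> = w\<^sup>-\<^sup>1\<close>, \<open>f = \<phi>\<sigma>\<close>, and \<open>f, s, w\<close> also denoting the averages of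
  \<open>f, \<sigma>, w\<close> over a dyadic interval, write \<open>s (1 \<plusminus> a)\<close> for the averages of \<open>\<sigma>\<close> over the two
  children and \<open>d = \<plusminus> (f\<^sub>\<plusminus> - s\<^sub>\<plusminus> f / s)\<close>. Then half the difference of the averages of \<open>f\<close>
  over the children is \<open>d + a f\<close>. The part \<open>d\<close> is paid for, at cost \<open>Q\<close>, by the increase of
  \<open>f\<^sup>2 / s\<close>. The part \<open>a f\<close> is a Carleson embedding: the function
  \<open>t = 2 s - 1 / w - s ln (s w) / (2 Q)\<close> lies between \<open>s\<close> and \<open>2 s\<close> on \<open>1 \<le> s w \<le> Q\<close> and
  exceeds its mean over the children by at least \<open>s a\<^sup>2 / (8 Q)\<close> (Buckley's inequality with linear
  dependence on \<open>Q\<close>), so \<open>f\<^sup>2 / t\<close> increases by at least a multiple of \<open>f\<^sup>2 a\<^sup>2 / (Q s)\<close>, and this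
  pays for \<open>a\<^sup>2 f\<^sup>2 w \<le> Q a\<^sup>2 f\<^sup>2 / s\<close> at cost \<open>Q\<^sup>2\<close>. Finally \<open>f\<^sup>2 \<le> s \<langle>\<phi>\<^sup>2\<sigma>\<rangle>\<close> bounds
  the total by Cauchy-Schwarz.

  Lower bound. For \<open>w = x powr (1 - 1 / N)\<close> and \<open>\<phi> = 1\<close>, each of the \<open>N\<close> intervals \<open>[0, 2\<^sup>-\<^sup>m)\<close>
  with \<open>m < N\<close> contributes at least a multiple of \<open>N\<^sup>2\<close>, whereas \<open>\<langle>\<sigma>\<rangle> = N\<close> on \<open>[0, 1)\<close> and the
  \<open>A\<^sub>2\<close> characteristic is \<open>N\<close> up to a constant.
\<close>

subsection \<open>The Bellman function\<close>

text \<open>Taylor bound for 2 cosh: integrate exp x + exp (-x) >= 2 twice from 0; evenness covers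
  negative \<open>y\<close>.\<close>

lemma sq_le_cosh:
  fixes y :: real
  shows "2 + y\<^sup>2 \<le> exp y + exp (- y)"
proof -
  have *: "2 + y\<^sup>2 \<le> exp y + exp (- y)" if "0 \<le> y" for y :: real
  proof -
    have 1: "2 * y \<le> exp y - exp (- y)" if "0 \<le> y" for y :: real
    proof -
      have "(\<lambda>y. exp y - exp (- y) - 2 * y) 0 \<le> (\<lambda>y. exp y - exp (- y) - 2 * y) y"
      proof (rule DERIV_nonneg_imp_nondecreasing[OF that])
        fix x :: real
        have "2 \<le> exp x + exp (- x)"
          using arith_geo_mean_sqrt[of "exp x" "exp (- x)"] by (simp flip: exp_add)
        then show "\<exists>y. ((\<lambda>y. exp y - exp (- y) - 2 * y) has_real_derivative y) (at x) \<and> 0 \<le> y"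
          by (intro exI[of _ "exp x + exp (- x) - 2"] conjI) (auto intro!: derivative_eq_intros)
      qed
      then show ?thesis by simp
    qed
    have "(\<lambda>y. exp y + exp (- y) - y\<^sup>2) 0 \<le> (\<lambda>y. exp y + exp (- y) - y\<^sup>2) y"
    proof (rule DERIV_nonneg_imp_nondecreasing[OF that])
      fix x :: real
      assume "0 \<le> x"
      then show "\<exists>y. ((\<lambda>y. exp y + exp (- y) - y\<^sup>2) has_real_derivative y) (at x) \<and> 0 \<le> y"
        using 1[of x]
        by (intro exI[of _ "exp x - exp (- x) - 2 * x"] conjI) (auto intro!: derivative_eq_intros)
    qed
    then show ?thesis by simp
  qed
  show ?thesis
    using *[of "\<bar>y\<bar>"] by (cases "0 \<le> y") (auto simp: abs_if)
qed

text \<open>Both sides are even and vanish at 0 together with their first derivatives, while the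
  second derivative of the right side is 2 / (1 - a^2) >= 2.\<close>

lemma entropy_ge_square:
  fixes a :: real
  assumes "\<bar>a\<bar> < 1"
  shows "a\<^sup>2 \<le> (1 + a) * ln (1 + a) + (1 - a) * ln (1 - a)"
proof -
  have *: "a\<^sup>2 \<le> (1 + a) * ln (1 + a) + (1 - a) * ln (1 - a)" if "0 \<le> a" "a < 1" for a :: real
  proof -
    have 1: "2 * a \<le> ln (1 + a) - ln (1 - a)" if "0 \<le> a" "a < 1" for a :: real
    proof -
      have "(\<lambda>y. ln (1 + y) - ln (1 - y) - 2 * y) 0 \<le> (\<lambda>y. ln (1 + y) - ln (1 - y) - 2 * y) a"
      proof (rule DERIV_nonneg_imp_nondecreasing[OF that(1)])
        fix x :: real
        assume x: "0 \<le> x" "x \<le> a"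
        have "0 \<le> 1 / (1 + x) + 1 / (1 - x) - 2"
        proof -
          have "1 / (1 + x) + 1 / (1 - x) - 2 = 2 * x\<^sup>2 / ((1 + x) * (1 - x))"
            using x that by (simp add: divide_simps) (simp add: power2_eq_square algebra_simps)
          then show ?thesis using x that by simp
        qed
        then show "\<exists>y. ((\<lambda>y. ln (1 + y) - ln (1 - y) - 2 * y) has_real_derivative y) (at x) \<and> 0 \<le> y"
          using x that
          by (intro exI[of _ "1 / (1 + x) + 1 / (1 - x) - 2"] conjI) (auto intro!: derivative_eq_intros)
      qed
      then show ?thesis by simp
    qed
    let ?h = "\<lambda>y. (1 + y) * ln (1 + y) + (1 - y) * ln (1 - y) - y\<^sup>2 :: real"
    have "?h 0 \<le> ?h a"
    proof (rule DERIV_nonneg_imp_nondecreasing[OF that(1)])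
      fix x :: real
      assume x: "0 \<le> x" "x \<le> a"
      have "(?h has_real_derivative ln (1 + x) - ln (1 - x) - 2 * x) (at x)"
      proof -
        have "(?h has_real_derivative (1 * ln (1 + x) + 1 / (1 + x) * (1 + x)) +
            ((- 1) * ln (1 - x) + - 1 / (1 - x) * (1 - x)) - 2 * x) (at x)"
          using x that by (auto intro!: derivative_eq_intros)
        then show ?thesis using x that by simp
      qed
      then show "\<exists>y. (?h has_real_derivative y) (at x) \<and> 0 \<le> y"
        using 1[of x] x that by (intro exI[of _ "ln (1 + x) - ln (1 - x) - 2 * x"] conjI) auto
    qed
    then show ?thesis by simp
  qed
  show ?thesis
    using *[of "\<bar>a\<bar>"] assms by (cases "0 \<le> a") (auto simp: abs_if)
qed

text \<open>Splitting the logarithms separates an entropy in \<open>a\<close>, the term ln (1 - b^2)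
  / 2, and a cross term a y / 2 with y = ln ((1 + b) / (1 - b)). Half the entropy gives a^2 / 2, of
  which the cross term costs a^2 / 4. With B = b^2 / (1 - b^2), the two other terms cost B / 2 + B,
  which the summand 2 B covers.\<close>

lemma cross_entropy_lower_bound:
  fixes a b :: real
  assumes "\<bar>a\<bar> < 1" "\<bar>b\<bar> < 1"
  shows "a\<^sup>2 / 4 \<le> 2 * (b\<^sup>2 / (1 - b\<^sup>2))
           + ((1 + a) * ln ((1 + a) * (1 + b)) + (1 - a) * ln ((1 - a) * (1 - b))) / 2"
proof -
  have b2: "0 < 1 - b\<^sup>2"
    using assms(2) by (simp add: abs_square_less_1)
  have b: "0 < 1 + b" "0 < 1 - b" "0 < 1 + a" "0 < 1 - a"
    using assms by auto
  define B where "B = b\<^sup>2 / (1 - b\<^sup>2)"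
  define y where "y = ln (1 + b) - ln (1 - b)"
  have "exp y + exp (- y) = (1 + b) / (1 - b) + (1 - b) / (1 + b)"
    using b by (simp add: y_def exp_diff exp_minus)
  also have "\<dots> = 2 + 4 * B"
    using b b2 unfolding B_def by (simp add: divide_simps) (simp add: power2_eq_square algebra_simps)
  finally have y: "y\<^sup>2 / 4 \<le> B"
    using sq_le_cosh[of y] by simp
  have "- (ln (1 + b) + ln (1 - b)) = ln (1 / (1 - b\<^sup>2))"
  proof -
    have "1 - b\<^sup>2 = (1 + b) * (1 - b)" by (simp add: power2_eq_square algebra_simps)
    then show ?thesis using b by (simp add: ln_div ln_mult)
  qed
  also have "\<dots> \<le> 1 / (1 - b\<^sup>2) - 1"
    using b2 by (intro ln_le_minus_one) simp
  also have "\<dots> = B"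
    using b2 by (simp add: B_def field_simps)
  finally have l: "- B \<le> ln (1 + b) + ln (1 - b)" by simp
  \<comment> \<open>Young's inequality for the cross term; y^2 / 4 <= B is \<open>sq_le_cosh\<close>
    at this \<open>y\<close>.\<close>
  have ay: "- (a\<^sup>2 / 4) - B \<le> a * y / 2"
    using y zero_le_power2[of "a / 2 + y / 2"] by (simp add: power2_eq_square algebra_simps)
  have "((1 + a) * ln ((1 + a) * (1 + b)) + (1 - a) * ln ((1 - a) * (1 - b))) / 2
      = ((1 + a) * ln (1 + a) + (1 - a) * ln (1 - a)) / 2 + (ln (1 + b) + ln (1 - b)) / 2 + a * y / 2"
  proof -
    have *: "((1 + a) * (A + B) + (1 - a) * (A' + B')) / 2
      = ((1 + a) * A + (1 - a) * A') / 2 + (B + B') / 2 + a * (B - B') / 2" for A A' B B' :: real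
      by (simp add: field_simps)
    show ?thesis
      using b *[of "ln (1 + a)" "ln (1 + b)" "ln (1 - a)" "ln (1 - b)"] by (simp add: ln_mult y_def)
  qed
  moreover have "0 \<le> B" using b2 by (simp add: B_def)
  moreover have "a\<^sup>2 / 4 \<le> 2 * B + E"
    if "E = p / 2 + q / 2 + r" "a\<^sup>2 \<le> p" "- B \<le> q" "- (a\<^sup>2 / 4) - B \<le> r" "0 \<le> B" for E p q r
    using that by simp
  ultimately show ?thesis
    using entropy_ge_square[OF assms(1)] l ay unfolding B_def[symmetric] by blast
qed

section \<open>The modified denominator and its concavity defect\<close>

definition bellman_denom :: "real \<Rightarrow> real \<Rightarrow> real \<Rightarrow> real" where
  "bellman_denom Q s w = 2 * s - 1 / w - s * ln (s * w) / (2 * Q)"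

text \<open>With x = s w in [1, Q], both subtracted terms are nonnegative, which gives the upper
  bound. The lower bound is x ln x <= Q (x - 1) <= 2 Q (x - 1), divided by 2 Q w.\<close>

lemma bellman_denom_bounds:
  assumes "0 < s" "0 < w" "1 \<le> s * w" "s * w \<le> Q"
  shows "s \<le> bellman_denom Q s w" "bellman_denom Q s w \<le> 2 * s"
proof -
  have Q: "0 < Q" using assms by linarith
  have "ln (s * w) \<le> s * w - 1"
    using assms by (intro ln_le_minus_one) auto
  have l0: "0 \<le> ln (s * w)" using assms by simp
  have "s * w * ln (s * w) \<le> Q * ln (s * w)"
    using assms l0 by (intro mult_right_mono) auto
  also have "\<dots> \<le> 2 * Q * (s * w - 1)"
    using Q \<open>ln (s * w) \<le> s * w - 1\<close> l0 by (simp add: mult.assoc)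
  finally have "s * ln (s * w) / (2 * Q) \<le> s - 1 / w"
    using assms Q by (simp add: field_simps)
  then show "s \<le> bellman_denom Q s w" by (simp add: bellman_denom_def)
  show "bellman_denom Q s w \<le> 2 * s"
  proof -
    have "0 \<le> 1 / w" "0 \<le> s * ln (s * w) / (2 * Q)"
      using assms Q l0 by auto
    then show ?thesis unfolding bellman_denom_def by linarith
  qed
qed

text \<open>The linear term has no defect, \<open>- 1 / w\<close> contributes exactly B / w, and the
  logarithmic term contributes s E / (2 Q), where E may be negative. Since s w <= Q, B / w is at
  least s (2 B) / (2 Q), precisely the compensation that \<open>cross_entropy_lower_bound\<close>
  asks for.\<close>

lemma bellman_denom_concavity_defect:
  fixes s w a b :: real
  assumes "0 < s" "0 < w" "s * w \<le> Q" "\<bar>a\<bar> < 1" "\<bar>b\<bar> < 1"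
  shows "(bellman_denom Q (s * (1 + a)) (w * (1 + b)) + bellman_denom Q (s * (1 - a)) (w * (1 - b))) / 2 + s * a\<^sup>2 / (8 * Q)
           \<le> bellman_denom Q s w"
proof -
  have Q: "0 < Q" using mult_pos_pos[OF assms(1,2)] assms(3) by linarith
  have b2: "0 < 1 - b\<^sup>2"
    using assms by (simp add: abs_square_less_1)
  have b: "0 < 1 + b" "0 < 1 - b" "0 < 1 + a" "0 < 1 - a"
    using assms by auto
  define E where "E = ((1 + a) * ln ((1 + a) * (1 + b)) + (1 - a) * ln ((1 - a) * (1 - b))) / 2"
  define B where "B = b\<^sup>2 / (1 - b\<^sup>2)"
  have ln1: "ln (s * (1 + a) * (w * (1 + b))) = ln (s * w) + ln ((1 + a) * (1 + b))"
    using assms b by (simp add: ln_mult)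
  have ln2: "ln (s * (1 - a) * (w * (1 - b))) = ln (s * w) + ln ((1 - a) * (1 - b))"
    using assms b by (simp add: ln_mult)
  have inv: "(1 / (w * (1 + b)) + 1 / (w * (1 - b))) / 2 = 1 / w + B / w"
    using b b2 assms unfolding B_def
    by (simp add: divide_simps) (simp add: power2_eq_square algebra_simps)
  have "bellman_denom Q s w - (bellman_denom Q (s * (1 + a)) (w * (1 + b)) + bellman_denom Q (s * (1 - a)) (w * (1 - b))) / 2
      = (1 / (w * (1 + b)) + 1 / (w * (1 - b))) / 2 - 1 / w + s * E / (2 * Q)"
  proof -
    have *: "2 * s - V - s * L / (2 * Q) - ((2 * (s * (1 + a)) - V1 - s * (1 + a) * (L + X) / (2 * Q))
        + (2 * (s * (1 - a)) - V2 - s * (1 - a) * (L + Y) / (2 * Q))) / 2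
      = (V1 + V2) / 2 - V + s * (((1 + a) * X + (1 - a) * Y) / 2) / (2 * Q)" for L X Y V V1 V2 :: real
      using Q by (simp add: divide_simps) (simp add: algebra_simps)
    show ?thesis
      unfolding bellman_denom_def ln1 ln2 E_def by (rule *)
  qed
  also have "\<dots> = B / w + s * E / (2 * Q)"
    unfolding inv by simp
  also have "B / w \<ge> s * (2 * B) / (2 * Q)"
  proof -
    have "0 \<le> B" using b2 by (simp add: B_def)
    then have "s * w * B \<le> Q * B"
      using assms by (intro mult_right_mono) auto
    then show ?thesis using assms Q by (simp add: field_simps)
  qed
  then have "B / w + s * E / (2 * Q) \<ge> s * (2 * B + E) / (2 * Q)"
    by (simp add: distrib_left add_divide_distrib)
  moreover have "s * (2 * B + E) / (2 * Q) \<ge> s * (a\<^sup>2 / 4) / (2 * Q)"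
    using cross_entropy_lower_bound[OF assms(4,5)] assms Q
    by (intro divide_right_mono mult_left_mono) (auto simp: B_def E_def)
  ultimately show ?thesis by (simp add: field_simps)
qed

section \<open>The Bellman function: size and one-step inequality\<close>

lemma square_over_linear_convex:
  fixes f g :: real
  assumes "0 < s" "0 < t"
  shows "((f + g) / 2)\<^sup>2 / ((s + t) / 2) \<le> (f\<^sup>2 / s + g\<^sup>2 / t) / 2"
proof -
  \<comment> \<open>After clearing denominators the convexity gap is exactly this square.\<close>
  have "0 \<le> (f * t - g * s)\<^sup>2" by simp
  then have "s * t * (f + g)\<^sup>2 \<le> (f\<^sup>2 * t + g\<^sup>2 * s) * (s + t)"
    by (simp add: power2_eq_square algebra_simps)
  then show ?thesis
    using assms by (simp add: divide_simps) (simp add: power2_eq_square algebra_simps)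
qed

text \<open>The weights 8 Q and 64 Q^2 are fixed by \<open>bellman_step\<close>: the first summand
  pays for the part \<open>d\<close> of the difference, the second for the part
  \<open>a * f\<close>. Their sum 8 + 64 is the 72 of the upper bound.\<close>

definition bellman :: "real \<Rightarrow> real \<Rightarrow> real \<Rightarrow> real \<Rightarrow> real" where
  "bellman Q f s w = 8 * Q * (f\<^sup>2 / s) + 64 * Q\<^sup>2 * (f\<^sup>2 / bellman_denom Q s w)"

lemma bellman_upper:
  assumes "0 < s" "0 < w" "1 \<le> s * w" "s * w \<le> Q" "f\<^sup>2 \<le> F * s"
  shows "bellman Q f s w \<le> 72 * Q\<^sup>2 * F"
proof -
  have Q: "1 \<le> Q" using assms by linarith
  have fF: "f\<^sup>2 / s \<le> F" using assms by (simp add: field_simps)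
  then have F: "0 \<le> F" using assms by (smt (verit) divide_nonneg_pos zero_le_power2)
  have "f\<^sup>2 / bellman_denom Q s w \<le> f\<^sup>2 / s"
    using bellman_denom_bounds[OF assms(1-4)] assms by (intro divide_left_mono) (auto intro!: mult_pos_pos)
  then have 1: "64 * Q\<^sup>2 * (f\<^sup>2 / bellman_denom Q s w) \<le> 64 * Q\<^sup>2 * F"
    using fF by (intro mult_left_mono) auto
  have "Q * (f\<^sup>2 / s) \<le> Q * F"
    using fF Q by (intro mult_left_mono) auto
  also have "\<dots> \<le> Q\<^sup>2 * F"
    using Q F by (intro mult_right_mono) (auto simp: power2_eq_square)
  finally show ?thesis using 1 unfolding bellman_def by simp
qed

text \<open>The main inequality for one dyadic splitting: the index 1 or 2 refers to a child, the
  added square is the martingale difference. Multiplied by the length of the interval, it telescopes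
  down the dyadic tree.\<close>

lemma bellman_step:
  fixes f1 f2 s1 s2 w1 w2 :: real
  defines "f \<equiv> (f1 + f2) / 2" and "s \<equiv> (s1 + s2) / 2" and "w \<equiv> (w1 + w2) / 2"
  assumes pos: "0 < s1" "0 < s2" "0 < w1" "0 < w2"
    and A1: "1 \<le> s1 * w1" "s1 * w1 \<le> Q"
    and A2: "1 \<le> s2 * w2" "s2 * w2 \<le> Q"
    and A: "1 \<le> s * w" "s * w \<le> Q"
  shows "bellman Q f s w + ((f1 - f2) / 2)\<^sup>2 * w \<le> (bellman Q f1 s1 w1 + bellman Q f2 s2 w2) / 2"
proof -
  have sw: "0 < s" "0 < w" using pos by (auto simp: s_def w_def)
  have Q: "1 \<le> Q" using A by linarith
  define a where "a = (s1 - s2) / (s1 + s2)"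
  define b where "b = (w1 - w2) / (w1 + w2)"
  have ab: "\<bar>a\<bar> < 1" "\<bar>b\<bar> < 1"
    using pos by (auto simp: a_def b_def abs_less_iff field_simps)
  have eqs: "s1 = s * (1 + a)" "s2 = s * (1 - a)" "w1 = w * (1 + b)" "w2 = w * (1 - b)"
    using pos by (auto simp: a_def b_def s_def w_def field_simps)
  define t1 where "t1 = bellman_denom Q s1 w1"
  define t2 where "t2 = bellman_denom Q s2 w2"
  define t where "t = bellman_denom Q s w"
  define m where "m = (t1 + t2) / 2"
  have t: "s1 \<le> t1" "s2 \<le> t2" "t \<le> 2 * s" "s \<le> t"
    using bellman_denom_bounds(1)[OF pos(1,3) A1] bellman_denom_bounds(1)[OF pos(2,4) A2] bellman_denom_bounds[OF sw A]
    by (auto simp: t1_def t2_def t_def)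
  have m: "0 < m" using t pos by (simp add: m_def)
  have def: "m + s * a\<^sup>2 / (8 * Q) \<le> t"
    using bellman_denom_concavity_defect[OF sw A(2) ab] unfolding m_def t1_def t2_def t_def eqs .
  have mt: "m \<le> t" using def sw Q by (smt (verit) divide_nonneg_pos mult_nonneg_nonneg zero_le_power2)

  \<comment> \<open>The gain is 1 / m - 1 / t = (t - m) / (m t), with numerator at least s a^2 / (8
    Q) and denominator at most 4 s^2. Passing from \<open>m\<close> to the children is joint
    convexity.\<close>
  have "f\<^sup>2 / t + f\<^sup>2 * a\<^sup>2 / (32 * Q * s) \<le> f\<^sup>2 / m"
  proof -
    have "m * t \<le> (2 * s) * (2 * s)"
      using mt t m sw by (intro mult_mono) auto
    then have "(s * a\<^sup>2 / (8 * Q)) / ((2 * s) * (2 * s)) \<le> (t - m) / (m * t)"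
      using def m mt sw Q by (intro frac_le) auto
    also have "(t - m) / (m * t) = 1 / m - 1 / t"
      using m mt by (simp add: field_simps)
    finally have "a\<^sup>2 / (32 * Q * s) \<le> 1 / m - 1 / t"
      using sw Q by (simp add: field_simps power2_eq_square)
    then have "f\<^sup>2 * (a\<^sup>2 / (32 * Q * s)) \<le> f\<^sup>2 * (1 / m - 1 / t)"
      by (intro mult_left_mono) auto
    then show ?thesis by (simp add: algebra_simps)
  qed
  also have "f\<^sup>2 / m \<le> (f1\<^sup>2 / t1 + f2\<^sup>2 / t2) / 2"
    unfolding f_def m_def using t pos by (intro square_over_linear_convex) auto
  finally have X: "64 * Q\<^sup>2 * (f\<^sup>2 / t + f\<^sup>2 * a\<^sup>2 / (32 * Q * s))
      \<le> 64 * Q\<^sup>2 * ((f1\<^sup>2 / t1 + f2\<^sup>2 / t2) / 2)"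
    by (intro mult_left_mono) auto
  have Xe: "64 * Q\<^sup>2 * (f\<^sup>2 * a\<^sup>2 / (32 * Q * s)) = 2 * Q * (f\<^sup>2 * a\<^sup>2 / s)"
    using Q by (simp add: power2_eq_square)

  define d where "d = f1 - s1 * f / s"
  define v where "v = (f1\<^sup>2 / s1 + f2\<^sup>2 / s2) / 2 - f\<^sup>2 / s"
  have f12: "f1 = d + (1 + a) * f" "f2 = (1 - a) * f - d"
  proof -
    show "f1 = d + (1 + a) * f" using sw by (simp add: d_def eqs(1))
    moreover have "f1 + f2 = 2 * f" by (simp add: f_def)
    ultimately show "f2 = (1 - a) * f - d" by (simp add: algebra_simps)
  qed
  have ab': "1 + a > 0" "1 - a > 0" using ab by auto
  \<comment> \<open>The terms linear in \<open>d\<close> cancel between the children, so the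
    convexity gain of f^2 / s is exactly this mean; then each child average of the dual weight is at
    most 2 s.\<close>
  have "v = (d\<^sup>2 / s1 + d\<^sup>2 / s2) / 2"
    using ab' sw unfolding v_def f12 eqs
    by (simp add: divide_simps) (simp add: power2_eq_square algebra_simps)
  moreover have "d\<^sup>2 / (2 * s) \<le> d\<^sup>2 / s1" "d\<^sup>2 / (2 * s) \<le> d\<^sup>2 / s2"
    using pos sw by (intro divide_left_mono; simp add: s_def)+
  moreover have "p \<le> x \<Longrightarrow> p \<le> y \<Longrightarrow> p \<le> (x + y) / 2" for p x y :: real by simp
  ultimately have "d\<^sup>2 / (2 * s) \<le> v" by metis
  then have v: "d\<^sup>2 \<le> 2 * s * v"
    using sw by (simp add: field_simps)
  then have v0: "0 \<le> v" using sw by (smt (verit) mult_pos_pos zero_le_power2 mult_less_0_iff)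
  have "(d + a * f)\<^sup>2 \<le> 2 * d\<^sup>2 + 2 * (a * f)\<^sup>2"
    using zero_le_power2[of "d - a * f"] by (simp add: power2_eq_square algebra_simps)
  moreover have "(f1 - f2) / 2 = d + a * f"
    unfolding f12 by (simp add: algebra_simps)
  ultimately have "((f1 - f2) / 2)\<^sup>2 \<le> 2 * d\<^sup>2 + 2 * (a * f)\<^sup>2" by metis
  then have "((f1 - f2) / 2)\<^sup>2 * w \<le> (2 * d\<^sup>2 + 2 * (a * f)\<^sup>2) * w"
    using sw by (intro mult_right_mono) auto
  also have "\<dots> \<le> 8 * Q * v + 2 * Q * (f\<^sup>2 * a\<^sup>2 / s)"
  proof -
    have "d\<^sup>2 * w \<le> 2 * s * v * w" using v sw by (intro mult_right_mono) auto
    also have "\<dots> = 2 * (s * w) * v" by simp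
    also have "\<dots> \<le> 2 * Q * v" using A v0 by (intro mult_right_mono) auto
    finally have 1: "d\<^sup>2 * w \<le> 4 * Q * v" using mult_nonneg_nonneg[OF _ v0, of Q] Q by simp
    have "(f\<^sup>2 * a\<^sup>2 / s) * (s * w) \<le> (f\<^sup>2 * a\<^sup>2 / s) * Q"
      using A sw by (intro mult_left_mono) auto
    then have "(a * f)\<^sup>2 * w \<le> Q * (f\<^sup>2 * a\<^sup>2 / s)"
      using sw by (simp add: power_mult_distrib field_simps)
    moreover have "(2 * d\<^sup>2 + 2 * (a * f)\<^sup>2) * w = 2 * (d\<^sup>2 * w) + 2 * ((a * f)\<^sup>2 * w)"
      by (simp add: algebra_simps)
    ultimately show ?thesis using 1 by linarith
  qed
  finally have Y: "((f1 - f2) / 2)\<^sup>2 * w \<le> 8 * Q * v + 2 * Q * (f\<^sup>2 * a\<^sup>2 / s)" .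
  \<comment> \<open>The remaining bookkeeping is linear once the quotients are abstracted to
    variables.\<close>
  have "8 * Q * x + 64 * Q\<^sup>2 * p + e \<le> ((8 * Q * x1 + 64 * Q\<^sup>2 * p1) + (8 * Q * x2 + 64 * Q\<^sup>2 * p2)) / 2"
    if "e \<le> 8 * Q * ((x1 + x2) / 2 - x) + 2 * Q * c"
      "64 * Q\<^sup>2 * (p + r) \<le> 64 * Q\<^sup>2 * ((p1 + p2) / 2)" "64 * Q\<^sup>2 * r = 2 * Q * c"
    for e x x1 x2 p p1 p2 r c :: real
    using that by (simp add: field_simps)
  from this[OF Y[unfolded v_def] X Xe] show ?thesis
    unfolding bellman_def t_def t1_def t2_def .
qed

subsection \<open>Dyadic averages and the upper bound\<close>

lemma powi_pred: "(2::real) powi n = 2 * 2 powi (n - 1)"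
  by (simp add: power_int_diff)

lemma dyadic_interval_lmeasurable [simp]: "dyadic_interval n k \<in> lmeasurable"
  by (rule bounded_set_imp_lmeasurable) (auto simp: dyadic_interval_def)

lemma dyadic_interval_sets [simp]: "dyadic_interval n k \<in> sets lebesgue"
  by (simp add: dyadic_interval_def)

lemma measure_dyadic_interval [simp]: "measure lebesgue (dyadic_interval n k) = 2 powi n"
proof -
  have "(0::real) < 2 powi n" by simp
  then show ?thesis
    by (simp add: dyadic_interval_def algebra_simps)
qed

lemma left_endpoint_in_dyadic_interval: "of_int k * 2 powi n \<in> dyadic_interval n k"
  by (simp add: dyadic_interval_def)

lemma dyadic_interval_split:
  "dyadic_interval n k = dyadic_interval (n - 1) (2 * k) \<union> dyadic_interval (n - 1) (2 * k + 1)"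
  "dyadic_interval (n - 1) (2 * k) \<inter> dyadic_interval (n - 1) (2 * k + 1) = {}"
  unfolding halves_dyadic[symmetric] left_half_def right_half_def by auto

lemma dyadic_child_subset:
  "dyadic_interval (n - 1) (2 * k) \<subseteq> dyadic_interval n k"
  "dyadic_interval (n - 1) (2 * k + 1) \<subseteq> dyadic_interval n k"
  using dyadic_interval_split(1) by blast+

lemma abs_mart_diff_dyadic:
  "abs_mart_diff (dyadic_interval n k) f =
     \<bar>avg f (dyadic_interval (n - 1) (2 * k)) - avg f (dyadic_interval (n - 1) (2 * k + 1))\<bar> / 2"
  by (simp add: abs_mart_diff_def halves_dyadic abs_minus_commute)

text \<open>Finite truncation of \<open>dyadic_subintervals\<close>, suited to induction. Depth 0 is
  empty, so depth \<open>N\<close> holds the scales from \<open>n\<close> down to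
  \<open>n - N + 1\<close>; hence the strict bound \<open>n - m < int N\<close> below.\<close>

primrec dyadic_tree :: "nat \<Rightarrow> int \<Rightarrow> int \<Rightarrow> real set set" where
  "dyadic_tree 0 n k = {}"
| "dyadic_tree (Suc N) n k = insert (dyadic_interval n k)
     (dyadic_tree N (n - 1) (2 * k) \<union> dyadic_tree N (n - 1) (2 * k + 1))"

lemma finite_dyadic_tree [simp]: "finite (dyadic_tree N n k)"
  by (induction N arbitrary: n k) auto

lemma dyadic_tree_mono: "M \<le> N \<Longrightarrow> dyadic_tree M n k \<subseteq> dyadic_tree N n k"
proof (induction N arbitrary: M n k)
  case (Suc N)
  then show ?case by (cases M) fastforce+
qed simp

text \<open>Descend to the child containing the small interval. Comparing lengths gives
  \<open>m \<le> n\<close>, so the base case is contradictory and at equal scale the intervals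
  coincide.\<close>

lemma subinterval_in_dyadic_tree:
  assumes "dyadic_interval m j \<subseteq> dyadic_interval n k" "n - m < int N"
  shows "dyadic_interval m j \<in> dyadic_tree N n k"
  using assms
proof (induction N arbitrary: n k)
  case 0
  have "measure lebesgue (dyadic_interval m j) \<le> measure lebesgue (dyadic_interval n k)"
    using 0 by (intro measure_mono_fmeasurable) auto
  then show ?case using 0 power_int_strict_increasing[of n m "2::real"] by force
next
  case (Suc N)
  let ?p = "(2::real) powi m"
  have p: "0 < ?p" by simp
  have "measure lebesgue (dyadic_interval m j) \<le> measure lebesgue (dyadic_interval n k)"
    using Suc.prems by (intro measure_mono_fmeasurable) auto
  then have "m \<le> n" using power_int_strict_increasing[of n m "2::real"] by force
  show ?case
  proof (cases "m = n")
    case True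
    have "of_int j * ?p \<in> dyadic_interval n k"
      using Suc.prems left_endpoint_in_dyadic_interval by blast
    then have "real_of_int k \<le> of_int j" "real_of_int j < of_int k + 1"
      using p True by (auto simp: dyadic_interval_def)
    then have "j = k" by linarith
    then show ?thesis using True by simp
  next
    case False
    define d where "d = nat (n - 1 - m)"
    have "n - 1 = int d + m"
      using False \<open>m \<le> n\<close> by (simp add: d_def)
    then have h: "(2::real) powi (n - 1) = of_int (2 ^ d) * ?p"
      by (simp add: power_int_add)
    define e where "e = (2 * k + 1) * 2 ^ d"
    \<comment> \<open>The midpoint of the large interval is an integer multiple of the small length,
      so the small interval cannot straddle it.\<close>
    have e: "(2 * of_int k + 1) * 2 powi (n - 1) = of_int e * ?p"
      by (simp add: h e_def)
    have bnd: "n - 1 - m < int N" using Suc.prems by simp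
    show ?thesis
    proof (cases "j < e")
      case True
      then have "of_int j + 1 \<le> real_of_int e" by linarith
      then have je: "(of_int j + 1) * ?p \<le> of_int e * ?p" by (intro mult_right_mono) auto
      have "dyadic_interval m j \<subseteq> dyadic_interval (n - 1) (2 * k)"
      proof
        fix x assume x: "x \<in> dyadic_interval m j"
        then have "x \<in> dyadic_interval n k" using Suc.prems by blast
        then have "of_int k * (2 * 2 powi (n - 1)) \<le> x" "x < (of_int j + 1) * ?p"
          using x by (auto simp: dyadic_interval_def powi_pred[of n])
        moreover from this je have "x < of_int e * ?p" by linarith
        ultimately have "of_int (2 * k) * 2 powi (n - 1) \<le> x" "x < (of_int (2 * k) + 1) * 2 powi (n - 1)"
          using e by auto
        then show "x \<in> dyadic_interval (n - 1) (2 * k)"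
          by (simp add: dyadic_interval_def)
      qed
      from Suc.IH[OF this bnd] show ?thesis by simp
    next
      case False
      then have "real_of_int e \<le> of_int j" by linarith
      then have je: "of_int e * ?p \<le> of_int j * ?p" by (intro mult_right_mono) auto
      have "dyadic_interval m j \<subseteq> dyadic_interval (n - 1) (2 * k + 1)"
      proof
        fix x assume x: "x \<in> dyadic_interval m j"
        then have "x \<in> dyadic_interval n k" using Suc.prems by blast
        then have "x < (of_int k + 1) * (2 * 2 powi (n - 1))" "of_int j * ?p \<le> x"
          using x by (auto simp: dyadic_interval_def powi_pred[of n])
        moreover from this je have "of_int e * ?p \<le> x" by linarith
        ultimately have "x < (of_int (2 * k + 1) + 1) * 2 powi (n - 1)" "of_int (2 * k + 1) * 2 powi (n - 1) \<le> x"
          using e by (auto simp: algebra_simps)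
        then show "x \<in> dyadic_interval (n - 1) (2 * k + 1)"
          by (simp add: dyadic_interval_def)
      qed
      from Suc.IH[OF this bnd] show ?thesis by simp
    qed
  qed
qed

lemma finite_subset_dyadic_tree:
  assumes "finite A" "A \<subseteq> dyadic_subintervals (dyadic_interval n k)"
  shows "\<exists>N. A \<subseteq> dyadic_tree N n k"
  using assms
proof (induction A rule: finite_induct)
  case (insert I A)
  then obtain N where N: "A \<subseteq> dyadic_tree N n k" by auto
  from insert.prems obtain m j where I: "I = dyadic_interval m j" "I \<subseteq> dyadic_interval n k"
    by (auto simp: dyadic_subintervals_def dyadic_intervals_def)
  have "I \<in> dyadic_tree (nat (n - m) + 1) n k"
    using I subinterval_in_dyadic_tree[of m j n k "nat (n - m) + 1"] by simp
  then have "insert I A \<subseteq> dyadic_tree (max N (nat (n - m) + 1)) n k"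
    using N dyadic_tree_mono[of N "max N (nat (n - m) + 1)" n k]
      dyadic_tree_mono[of "nat (n - m) + 1" "max N (nat (n - m) + 1)" n k] by auto
  then show ?case by blast
qed simp

text \<open>\<open>U\<close> is a supersolution: each split releases at least \<open>g\<close>, and
  nonnegativity of \<open>U\<close> discards what remains at the leaves. Nonnegativity of
  \<open>g\<close> lets sums over possibly overlapping sets be bounded without proving
  disjointness.\<close>

lemma sum_dyadic_tree_le:
  fixes g :: "real set \<Rightarrow> real"
  assumes g: "\<And>I. 0 \<le> g I"
    and U: "\<And>n k. dyadic_interval n k \<subseteq> J \<Longrightarrow> 0 \<le> U n k"
    and step: "\<And>n k. dyadic_interval n k \<subseteq> J \<Longrightarrow>
      g (dyadic_interval n k) + (U (n - 1) (2 * k) + U (n - 1) (2 * k + 1)) \<le> U n k"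
    and "dyadic_interval n k \<subseteq> J"
  shows "sum g (dyadic_tree N n k) \<le> U n k"
  using assms(4)
proof (induction N arbitrary: n k)
  case 0
  then show ?case using U by simp
next
  case (Suc N)
  let ?L = "dyadic_tree N (n - 1) (2 * k)" and ?R = "dyadic_tree N (n - 1) (2 * k + 1)"
  have "sum g (dyadic_tree (Suc N) n k) \<le> g (dyadic_interval n k) + sum g (?L \<union> ?R)"
    using g by (simp add: sum.insert_if)
  also have "sum g (?L \<union> ?R) \<le> sum g ?L + sum g ?R"
    using g by (simp add: sum_Un sum_nonneg)
  also have "sum g ?L + sum g ?R \<le> U (n - 1) (2 * k) + U (n - 1) (2 * k + 1)"
    using Suc.IH Suc.prems dyadic_child_subset[where n = n and k = k] by (intro add_mono) (meson subset_trans)+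
  finally show ?case using step[OF Suc.prems] by simp
qed

section \<open>Averages of functions and weights over dyadic intervals\<close>

lemma avg_dyadic_split:
  assumes "set_integrable lebesgue (dyadic_interval n k) f"
  shows "avg f (dyadic_interval n k)
    = (avg f (dyadic_interval (n - 1) (2 * k)) + avg f (dyadic_interval (n - 1) (2 * k + 1))) / 2"
proof -
  have sub: "set_integrable lebesgue (dyadic_interval (n - 1) (2 * k)) f"
      "set_integrable lebesgue (dyadic_interval (n - 1) (2 * k + 1)) f"
    by (rule set_integrable_subset[OF assms dyadic_interval_sets dyadic_child_subset(1)],
        rule set_integrable_subset[OF assms dyadic_interval_sets dyadic_child_subset(2)])
  have "(LINT x:dyadic_interval n k|lebesgue. f x)
      = (LINT x:dyadic_interval (n - 1) (2 * k)|lebesgue. f x)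
        + (LINT x:dyadic_interval (n - 1) (2 * k + 1)|lebesgue. f x)"
    using set_integral_Un[OF dyadic_interval_split(2) sub] by (simp only: dyadic_interval_split(1)[of n k])
  then show ?thesis
    by (simp add: avg_def powi_pred[of n] field_simps)
qed

lemma locally_integrable_dyadic:
  assumes "locally_integrable f"
  shows "set_integrable lebesgue (dyadic_interval n k) f"
proof -
  have "set_integrable lebesgue {of_int k * 2 powi n .. (of_int k + 1) * 2 powi n} f"
    using assms by (auto simp: locally_integrable_def)
  then show ?thesis
    by (rule set_integrable_subset) (auto simp: dyadic_interval_def)
qed

lemma avg_pos:
  assumes "set_integrable lebesgue (dyadic_interval n k) f" "\<And>x. 0 < f x"
  shows "0 < avg f (dyadic_interval n k)"
proof -
  let ?I = "dyadic_interval n k"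
  have "(LINT x:?I|lebesgue. f x) \<noteq> 0"
  proof
    assume "(LINT x:?I|lebesgue. f x) = 0"
    moreover have "integrable lebesgue (\<lambda>x. indicator ?I x *\<^sub>R f x)"
      using assms(1) by (simp add: set_integrable_def)
    moreover have "AE x in lebesgue. 0 \<le> indicator ?I x *\<^sub>R f x"
      using assms(2) by (intro AE_I2) (simp add: less_imp_le)
    ultimately have AE: "AE x in lebesgue. indicator ?I x *\<^sub>R f x = 0"
      unfolding set_lebesgue_integral_def using integral_nonneg_eq_0_iff_AE by blast
    have nz: "f x \<noteq> 0" for x using assms(2)[of x] by simp
    have "AE x in lebesgue. x \<notin> ?I"
      by (rule eventually_mono[OF AE]) (simp add: nz indicator_eq_0_iff)
    then have "?I \<in> null_sets lebesgue"
      by (simp add: AE_iff_null_sets)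
    then have "emeasure lebesgue ?I = 0" by blast
    then have "measure lebesgue ?I = 0" by (simp add: measure_def)
    then show False by simp
  qed
  moreover have "0 \<le> (LINT x:?I|lebesgue. f x)"
    unfolding set_lebesgue_integral_def using assms(2)
    by (intro integral_nonneg_AE) (auto simp: less_imp_le)
  ultimately show ?thesis by (simp add: avg_def)
qed

lemma avg_Cauchy_Schwarz:
  assumes "set_integrable lebesgue I \<sigma>" "set_integrable lebesgue I (\<lambda>x. \<phi> x * \<sigma> x)"
    "set_integrable lebesgue I (\<lambda>x. (\<phi> x)\<^sup>2 * \<sigma> x)" "\<And>x. 0 \<le> \<sigma> x" "0 < avg \<sigma> I"
  shows "(avg (\<lambda>x. \<phi> x * \<sigma> x) I)\<^sup>2 \<le> avg (\<lambda>x. (\<phi> x)\<^sup>2 * \<sigma> x) I * avg \<sigma> I"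
proof -
  \<comment> \<open>The minimiser of the quadratic obtained by expanding the integral of
    (\<open>\<phi>\<close> - t)^2 \<open>\<sigma>\<close>.\<close>
  define t where "t = avg (\<lambda>x. \<phi> x * \<sigma> x) I / avg \<sigma> I"
  have "0 \<le> (LINT x:I|lebesgue. (\<phi> x - t)\<^sup>2 * \<sigma> x)"
    unfolding set_lebesgue_integral_def using assms(4)
    by (intro integral_nonneg_AE) auto
  also have "\<dots> = (LINT x:I|lebesgue. ((\<phi> x)\<^sup>2 * \<sigma> x - 2 * t * (\<phi> x * \<sigma> x)) + t\<^sup>2 * \<sigma> x)"
    by (intro arg_cong[where f = "set_lebesgue_integral lebesgue I"] ext)
      (simp add: power2_eq_square algebra_simps)
  also have "\<dots> = (LINT x:I|lebesgue. (\<phi> x)\<^sup>2 * \<sigma> x) - 2 * t * (LINT x:I|lebesgue. \<phi> x * \<sigma> x)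
      + t\<^sup>2 * (LINT x:I|lebesgue. \<sigma> x)"
    using assms(1-3) by (simp add: set_integral_add set_integral_diff)
  finally have "0 \<le> (1 / measure lebesgue I) * ((LINT x:I|lebesgue. (\<phi> x)\<^sup>2 * \<sigma> x)
      - 2 * t * (LINT x:I|lebesgue. \<phi> x * \<sigma> x) + t\<^sup>2 * (LINT x:I|lebesgue. \<sigma> x))"
    by (intro mult_nonneg_nonneg) auto
  also have "\<dots> = avg (\<lambda>x. (\<phi> x)\<^sup>2 * \<sigma> x) I - 2 * t * avg (\<lambda>x. \<phi> x * \<sigma> x) I + t\<^sup>2 * avg \<sigma> I"
    by (simp add: avg_def algebra_simps add_divide_distrib diff_divide_distrib)
  also have "\<dots> = avg (\<lambda>x. (\<phi> x)\<^sup>2 * \<sigma> x) I - (avg (\<lambda>x. \<phi> x * \<sigma> x) I)\<^sup>2 / avg \<sigma> I"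
    using assms(5) by (simp add: t_def power2_eq_square field_simps)
  finally show ?thesis using assms(5) by (simp add: field_simps)
qed

lemma A2_char_le_imp:
  assumes "A2_char w \<le> ennreal Q" "0 \<le> Q"
  shows "avg w (dyadic_interval n k) * avg (\<lambda>x. inverse (w x)) (dyadic_interval n k) \<le> Q"
proof -
  have "ennreal (avg w (dyadic_interval n k) * avg (\<lambda>x. inverse (w x)) (dyadic_interval n k)) \<le> A2_char w"
    unfolding A2_char_def by (rule SUP_upper) (auto simp: dyadic_intervals_def)
  then show ?thesis using assms by (meson ennreal_le_iff order_trans)
qed

lemma weight_averages:
  assumes "weight w" "A2_char w \<le> ennreal Q" "0 \<le> Q"
  shows "0 < avg w (dyadic_interval n k)" "0 < avg (\<lambda>x. inverse (w x)) (dyadic_interval n k)"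
    "1 \<le> avg (\<lambda>x. inverse (w x)) (dyadic_interval n k) * avg w (dyadic_interval n k)"
    "avg (\<lambda>x. inverse (w x)) (dyadic_interval n k) * avg w (dyadic_interval n k) \<le> Q"
proof -
  let ?I = "dyadic_interval n k"
  have pos: "\<And>x. 0 < w x" and int: "set_integrable lebesgue ?I w"
      "set_integrable lebesgue ?I (\<lambda>x. inverse (w x))"
    using assms(1) locally_integrable_dyadic by (auto simp: weight_def)
  show w: "0 < avg w ?I" and s: "0 < avg (\<lambda>x. inverse (w x)) ?I"
    using int pos by (auto intro!: avg_pos)
  have eq: "w x * inverse (w x) = 1" "(w x)\<^sup>2 * inverse (w x) = w x" for x
    using pos[of x] by (auto simp: power2_eq_square)
  have "set_integrable lebesgue ?I (\<lambda>x. 1 :: real)"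
    by (simp add: set_integrable_def) (use dyadic_interval_lmeasurable in \<open>blast intro: lmeasurable_iff_integrable[THEN iffD1]\<close>)
  moreover have "avg (\<lambda>x. 1) ?I = 1"
    by (simp add: avg_def set_lebesgue_integral_def lmeasure_integral_UNIV[symmetric])
  \<comment> \<open>Cauchy-Schwarz with \<open>w\<close> in the role of \<open>\<phi>\<close>: the
    product with the dual weight is 1, and the square times the dual weight is
    \<open>w\<close>.\<close>
  ultimately show "1 \<le> avg (\<lambda>x. inverse (w x)) ?I * avg w ?I"
    using avg_Cauchy_Schwarz[of ?I "\<lambda>x. inverse (w x)" w, unfolded eq] int s pos
    by (simp add: less_imp_le mult.commute)
  show "avg (\<lambda>x. inverse (w x)) ?I * avg w ?I \<le> Q"
    using A2_char_le_imp[OF assms(2,3)] by (simp add: mult.commute)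
qed

text \<open>Domination by |\<open>\<phi>\<close>| <= \<open>\<phi>\<close>^2 + 1. Measurability is
  taken from \<open>\<sigma>\<close> cut off to \<open>I\<close>, since only integrability on
  \<open>I\<close> is given.\<close>

lemma set_integrable_of_square:
  fixes \<phi> \<sigma> :: "real \<Rightarrow> real"
  assumes "set_integrable lebesgue I \<sigma>" "set_integrable lebesgue I (\<lambda>x. (\<phi> x)\<^sup>2 * \<sigma> x)"
    "\<phi> \<in> borel_measurable lebesgue" "\<And>x. 0 \<le> \<sigma> x"
  shows "set_integrable lebesgue I (\<lambda>x. \<phi> x * \<sigma> x)"
proof (rule set_integrable_bound[where f = "\<lambda>x. (\<phi> x)\<^sup>2 * \<sigma> x + \<sigma> x"])
  show "set_integrable lebesgue I (\<lambda>x. (\<phi> x)\<^sup>2 * \<sigma> x + \<sigma> x)"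
    using assms by (intro set_integral_add)
  have "(\<lambda>x. indicator I x *\<^sub>R \<sigma> x) \<in> borel_measurable lebesgue"
    using assms(1) unfolding set_integrable_def by (rule borel_measurable_integrable)
  from borel_measurable_times[OF assms(3) this]
  show "set_borel_measurable lebesgue I (\<lambda>x. \<phi> x * \<sigma> x)"
    by (simp add: set_borel_measurable_def mult_ac)
  have "norm (\<phi> x * \<sigma> x) \<le> norm ((\<phi> x)\<^sup>2 * \<sigma> x + \<sigma> x)" for x
  proof -
    have "\<bar>\<phi> x\<bar> \<le> (\<phi> x)\<^sup>2 + 1"
      using zero_le_power2[of "\<bar>\<phi> x\<bar> - 1"] by (simp add: power2_diff)
    then have "\<bar>\<phi> x\<bar> * \<sigma> x \<le> ((\<phi> x)\<^sup>2 + 1) * \<sigma> x"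
      using assms(4) by (intro mult_right_mono)
    then show ?thesis using assms(4)[of x] by (simp add: abs_mult algebra_simps)
  qed
  then show "AE x in lebesgue. x \<in> I \<longrightarrow> norm (\<phi> x * \<sigma> x) \<le> norm ((\<phi> x)\<^sup>2 * \<sigma> x + \<sigma> x)"
    by simp
qed

lemma square_sum_le:
  assumes w: "weight w" "A2_char w \<le> ennreal Q" and Q: "1 \<le> Q"
    and J: "J \<in> dyadic_intervals" and \<phi>: "\<phi> \<in> borel_measurable lebesgue"
    and int: "set_integrable lebesgue J (\<lambda>x. (\<phi> x)\<^sup>2 * inverse (w x))"
  shows "square_sum w \<phi> J \<le> ennreal (72 * Q\<^sup>2 * avg (\<lambda>x. (\<phi> x)\<^sup>2 * inverse (w x)) J)"
proof -
  obtain n k where J_eq: "J = dyadic_interval n k"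
    using J by (auto simp: dyadic_intervals_def)
  define \<sigma> where "\<sigma> = (\<lambda>x. inverse (w x))"
  define \<psi> where "\<psi> = (\<lambda>x. \<phi> x * inverse (w x))"
  define \<rho> where "\<rho> = (\<lambda>x. (\<phi> x)\<^sup>2 * inverse (w x))"
  define g where "g I = (abs_mart_diff I \<psi>)\<^sup>2 * avg w I * measure lebesgue I" for I
  define V where "V I = bellman Q (avg \<psi> I) (avg \<sigma> I) (avg w I)" for I
  define U where "U n k = 2 powi n * (72 * Q\<^sup>2 * avg \<rho> (dyadic_interval n k) - V (dyadic_interval n k))" for n k
  have wpos: "\<And>x. 0 < w x" and wloc: "locally_integrable w" "locally_integrable \<sigma>"
    using w by (auto simp: weight_def \<sigma>_def)
  note wint = wloc[THEN locally_integrable_dyadic]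
  note av = weight_averages[OF w, folded \<sigma>_def]
  have Q0: "0 \<le> Q" using Q by simp
  have \<psi>int: "set_integrable lebesgue J \<psi>"
    unfolding \<psi>_def
    using set_integrable_of_square[OF wint(2)[of n k, unfolded \<sigma>_def, folded J_eq] int \<phi>] wpos
    by (simp add: less_imp_le)
  have sub: "set_integrable lebesgue (dyadic_interval m j) \<psi>" "set_integrable lebesgue (dyadic_interval m j) \<rho>"
    if "dyadic_interval m j \<subseteq> J" for m j
    using set_integrable_subset[OF \<psi>int dyadic_interval_sets that]
      set_integrable_subset[OF int dyadic_interval_sets that] unfolding \<rho>_def by blast+
  have V0: "0 \<le> V (dyadic_interval m j)" for m j
    using bellman_denom_bounds(1)[OF av(2,1,3,4)] av(2)[of m j] Q unfolding V_def bellman_def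
    by (intro add_nonneg_nonneg mult_nonneg_nonneg divide_nonneg_nonneg)
      (auto simp: less_imp_le intro: order_trans[OF less_imp_le])
  have U0: "0 \<le> U m j" if "dyadic_interval m j \<subseteq> J" for m j
  proof -
    let ?I = "dyadic_interval m j"
    have "(avg \<psi> ?I)\<^sup>2 \<le> avg \<rho> ?I * avg \<sigma> ?I"
      unfolding \<psi>_def \<rho>_def \<sigma>_def
      by (rule avg_Cauchy_Schwarz)
        (use sub[OF that] wint av(2) wpos in \<open>auto simp: \<psi>_def \<rho>_def \<sigma>_def less_imp_le Q0\<close>)
    then have "V ?I \<le> 72 * Q\<^sup>2 * avg \<rho> ?I"
      unfolding V_def using av Q by (intro bellman_upper) auto
    then show ?thesis by (simp add: U_def)
  qed
  have step: "g (dyadic_interval m j) + (U (m - 1) (2 * j) + U (m - 1) (2 * j + 1)) \<le> U m j"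
    if "dyadic_interval m j \<subseteq> J" for m j
  proof -
    let ?I = "dyadic_interval m j" and ?L = "dyadic_interval (m - 1) (2 * j)"
      and ?R = "dyadic_interval (m - 1) (2 * j + 1)"
    note split = avg_dyadic_split[OF sub(1)[OF that]] avg_dyadic_split[OF wint(2), of m j]
      avg_dyadic_split[OF wint(1), of m j]
    have "bellman Q (avg \<psi> ?I) (avg \<sigma> ?I) (avg w ?I) + ((avg \<psi> ?L - avg \<psi> ?R) / 2)\<^sup>2 * avg w ?I
        \<le> (V ?L + V ?R) / 2"
      unfolding V_def split using av Q by (intro bellman_step) (auto simp flip: split)
    then have "V ?I + ((avg \<psi> ?L - avg \<psi> ?R) / 2)\<^sup>2 * avg w ?I \<le> (V ?L + V ?R) / 2"
      by (simp add: V_def)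
    then have "2 powi m * (V ?I + ((avg \<psi> ?L - avg \<psi> ?R) / 2)\<^sup>2 * avg w ?I) \<le> 2 powi m * ((V ?L + V ?R) / 2)"
      by (intro mult_left_mono) auto
    moreover have "g ?I = 2 powi m * (((avg \<psi> ?L - avg \<psi> ?R) / 2)\<^sup>2 * avg w ?I)"
      by (simp add: g_def abs_mart_diff_dyadic power_divide)
    ultimately show ?thesis
      unfolding U_def powi_pred[of m] avg_dyadic_split[OF sub(2)[OF that]] by (simp add: algebra_simps)
  qed
  have g0: "0 \<le> g I" if "I \<in> dyadic_intervals" for I
    using that av(1) Q by (auto simp: g_def dyadic_intervals_def less_imp_le)
  \<comment> \<open>\<open>sum_dyadic_tree_le\<close> wants nonnegativity on every set, whereas
    \<open>g0\<close> gives it on dyadic intervals; there the truncation changes nothing.\<close>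
  define g' where "g' I = max 0 (g I)" for I
  have g': "g' I = g I" if "I \<in> dyadic_intervals" for I
    using g0[OF that] by (simp add: g'_def)
  have fin: "(\<Sum>I\<in>F. ennreal (g I)) \<le> ennreal (U n k)"
    if F: "finite F" "F \<subseteq> dyadic_subintervals J" for F
  proof -
    obtain N where N: "F \<subseteq> dyadic_tree N n k"
      using finite_subset_dyadic_tree F unfolding J_eq by blast
    have "(\<Sum>I\<in>F. ennreal (g I)) = (\<Sum>I\<in>F. ennreal (g' I))"
      using F g' by (intro sum.cong) (auto simp: dyadic_subintervals_def)
    also have "\<dots> = ennreal (sum g' F)"
      by (intro sum_ennreal) (simp add: g'_def)
    also have "sum g' F \<le> sum g' (dyadic_tree N n k)"
      using N by (intro sum_mono2) (auto simp: g'_def)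
    also have "\<dots> \<le> U n k"
    proof (rule sum_dyadic_tree_le[where J = J])
      show "g' (dyadic_interval m j) + (U (m - 1) (2 * j) + U (m - 1) (2 * j + 1)) \<le> U m j"
        if "dyadic_interval m j \<subseteq> J" for m j
      proof -
        have "g' (dyadic_interval m j) = g (dyadic_interval m j)"
          by (rule g') (auto simp: dyadic_intervals_def)
        then show ?thesis using step[OF that] by simp
      qed
    qed (use U0 J_eq in \<open>auto simp: g'_def\<close>)
    finally show ?thesis by (simp add: ennreal_leI)
  qed
  \<comment> \<open>A nonnegative infinite sum is the supremum of its finite partial sums, each of
    which lies in some tree.\<close>
  have "(\<Sum>\<^sub>\<infinity>I\<in>dyadic_subintervals J. ennreal (g I)) \<le> ennreal (U n k)"
    by (subst nonneg_infsum_complete) (auto intro!: SUP_least fin)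
  also have "U n k \<le> 2 powi n * (72 * Q\<^sup>2 * avg \<rho> J)"
    using V0[of n k] by (simp add: U_def J_eq)
  finally have "square_sum w \<phi> J \<le> ennreal (1 / 2 powi n) * ennreal (2 powi n * (72 * Q\<^sup>2 * avg \<rho> J))"
    unfolding square_sum_def g_def \<psi>_def J_eq measure_dyadic_interval
    by (intro mult_left_mono) (auto simp: ennreal_leI)
  also have "\<dots> = ennreal (72 * Q\<^sup>2 * avg \<rho> J)"
    by (subst ennreal_mult'[symmetric]) auto
  finally show ?thesis by (simp add: \<rho>_def)
qed

lemma C_s_le:
  assumes "1 \<le> Q"
  shows "C_s Q \<le> ennreal (72 * Q\<^sup>2)"
  unfolding C_s_def
proof (intro Inf_lower CollectI allI impI)
  fix w J \<phi>
  assume "admissible Q w J \<phi>"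
  then have "square_sum w \<phi> J \<le> ennreal (72 * Q\<^sup>2 * avg (\<lambda>x. (\<phi> x)\<^sup>2 * inverse (w x)) J)"
    using square_sum_le assms by (simp add: admissible_def)
  then show "square_sum w \<phi> J \<le> ennreal (72 * Q\<^sup>2) * ennreal (avg (\<lambda>x. (\<phi> x)\<^sup>2 * inverse (w x)) J)"
    by (simp add: ennreal_mult')
qed

subsection \<open>Power weights and the lower bound\<close>

text \<open>The value 1 off the positive half-line keeps the weight strictly positive everywhere and
  makes its inverse the power weight of the opposite exponent.\<close>

definition power_weight :: "real \<Rightarrow> real \<Rightarrow> real" where
  "power_weight p x = (if 0 < x then x powr p else 1)"

lemma power_weight_pos: "0 < power_weight p x"
  by (simp add: power_weight_def)

lemma inverse_power_weight: "inverse (power_weight p x) = power_weight (- p) x"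
  by (simp add: power_weight_def powr_minus)

lemma power_weight_has_integral:
  assumes "- 1 < q" "0 \<le> r"
  shows "(power_weight q has_integral r powr (q + 1) / (q + 1)) {0..r}"
proof (rule has_integral_spike_finite[OF _ _ has_integral_powr_from_0[OF assms]])
  show "power_weight q x = x powr q" if "x \<in> {0..r} - {0}" for x
    using that by (simp add: power_weight_def)
qed simp

lemma power_weight_locally_integrable:
  assumes "- 1 < q"
  shows "locally_integrable (power_weight q)"
  unfolding locally_integrable_def
proof (intro allI impI)
  fix K :: "real set"
  assume K: "compact K"
  then obtain R where R: "0 < R" "K \<subseteq> {- R..R}"
    using bounded_subset_cbox_symmetric[of K] compact_imp_bounded
    by (metis bounded_pos abs_le_iff atLeastAtMost_iff minus_le_iff real_norm_def subsetI)
  have "(\<lambda>x. 1 :: real) integrable_on {- R..0}"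
    by (rule integrable_const_ivl)
  then have "power_weight q integrable_on {- R..0}"
    by (rule integrable_eq) (simp add: power_weight_def)
  moreover have "power_weight q integrable_on {0..R}"
    using power_weight_has_integral[OF assms, of R] R by (auto simp: integrable_on_def)
  ultimately have "power_weight q integrable_on {- R..R}"
    using R by (intro Henstock_Kurzweil_Integration.integrable_combine[of "- R" 0 R]) auto
  then have "power_weight q absolutely_integrable_on {- R..R}"
    by (rule nonnegative_absolutely_integrable_1) (simp add: power_weight_pos less_imp_le)
  then show "set_integrable lebesgue K (power_weight q)"
    by (rule set_integrable_subset) (use K R in \<open>auto intro: lmeasurable_compact fmeasurableD\<close>)
qed

lemma avg_power_weight:
  assumes "- 1 < q"
  shows "avg (power_weight q) (dyadic_interval n 0) = (2 powi n) powr q / (q + 1)"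
proof -
  let ?r = "(2 :: real) powi n"
  have r: "0 < ?r" by simp
  have I: "dyadic_interval n 0 = {0..<?r}" by (simp add: dyadic_interval_def)
  have "(power_weight q has_integral ?r powr (q + 1) / (q + 1)) {0..<?r}"
    using power_weight_has_integral[OF assms less_imp_le[OF r]]
    by (rule has_integral_spike_set_eq[THEN iffD1, rotated -1]) (auto intro: negligible_subset[of "{?r}"])
  then have "integral (dyadic_interval n 0) (power_weight q) = ?r powr (q + 1) / (q + 1)"
    unfolding I by (rule integral_unique)
  then have "(LINT x:dyadic_interval n 0|lebesgue. power_weight q x) = ?r powr (q + 1) / (q + 1)"
    using set_lebesgue_integral_eq_integral(2)[OF locally_integrable_dyadic[OF
        power_weight_locally_integrable[OF assms]]] by simp
  then show ?thesis
    using r by (simp add: avg_def powr_add)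
qed

lemma avg_le:
  assumes "set_integrable lebesgue (dyadic_interval n k) f" "\<And>x. x \<in> dyadic_interval n k \<Longrightarrow> f x \<le> c"
  shows "avg f (dyadic_interval n k) \<le> c"
proof -
  let ?I = "dyadic_interval n k"
  have "(LINT x:?I|lebesgue. f x) \<le> (LINT x:?I|lebesgue. c)"
  proof (rule set_integral_mono[OF assms(1)])
    have "integrable lebesgue (indicat_real ?I)"
      using dyadic_interval_lmeasurable lmeasurable_iff_integrable by blast
    then show "set_integrable lebesgue ?I (\<lambda>x. c)"
      by (simp add: set_integrable_def)
  qed (use assms(2) in auto)
  also have "(LINT x:?I|lebesgue. c) = 2 powi n * c"
    using dyadic_interval_lmeasurable[of n k]
    by (subst set_integral_const) (auto simp: fmeasurable_def)
  finally show ?thesis by (simp add: avg_def field_simps)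
qed

text \<open>Intervals starting at 0 give exactly 1 / ((1 + p) (1 - p)). To the left of 0 both
  weights are 1. To the right, the interval is no longer than its distance \<open>l\<close> from 0,
  so the weight varies by a factor at most 2.\<close>

lemma A2_power_weight:
  assumes "0 \<le> p" "p < 1"
  shows "A2_char (power_weight p) \<le> ennreal (max 2 (1 / (1 - p)))"
  unfolding A2_char_def
proof (rule SUP_least)
  fix J assume "J \<in> dyadic_intervals"
  then obtain n k where J: "J = dyadic_interval n k" by (auto simp: dyadic_intervals_def)
  have q: "- 1 < p" "- 1 < - p" using assms by auto
  note int = locally_integrable_dyadic[OF power_weight_locally_integrable]
  have pos: "0 < avg (power_weight p) J" "0 < avg (power_weight (- p)) J"
    unfolding J by (auto intro!: avg_pos int q power_weight_pos)
  have le: "avg (power_weight p) J * avg (power_weight (- p)) J \<le> a * b"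
    if "\<And>x. x \<in> J \<Longrightarrow> power_weight p x \<le> a" "\<And>x. x \<in> J \<Longrightarrow> power_weight (- p) x \<le> b" for a b
  proof -
    have "avg (power_weight p) J \<le> a" "avg (power_weight (- p)) J \<le> b"
      using that unfolding J by (auto intro!: avg_le int q)
    then show ?thesis using pos by (intro mult_mono) auto
  qed
  have "avg (power_weight p) J * avg (power_weight (- p)) J \<le> max 2 (1 / (1 - p))"
  proof (cases "k = 0")
    case True
    have "avg (power_weight p) J * avg (power_weight (- p)) J = 1 / ((p + 1) * (1 - p))"
      unfolding J True avg_power_weight[OF q(1)] avg_power_weight[OF q(2)]
      by (simp add: powr_minus)
    also have "\<dots> \<le> 1 / (1 - p)"
      using assms by (intro divide_left_mono) (auto simp: mult_le_cancel_right1)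
    finally show ?thesis by simp
  next
    case False
    show ?thesis
    proof (cases "k < 0")
      case True
      then have "(of_int k + 1) * 2 powi n \<le> (0::real)"
        by (intro mult_nonpos_nonneg) auto
      then have "power_weight p x \<le> 1 \<and> power_weight (- p) x \<le> 1" if "x \<in> J" for x
        using that by (auto simp: J dyadic_interval_def power_weight_def)
      then show ?thesis using le[of 1 1] by simp
    next
      case k: False
      define l :: real where "l = of_int k * 2 powi n"
      have l: "0 < l" using k False by (simp add: l_def)
      have "(1 :: real) * 2 powi n \<le> l"
        unfolding l_def using k False by (intro mult_right_mono) auto
      then have x: "l \<le> x" "x \<le> 2 * l" if "x \<in> J" for x
      proof -
        have "l \<le> x" "x < l + 2 powi n"
          using that by (auto simp: J dyadic_interval_def l_def algebra_simps)
        then show "l \<le> x" "x \<le> 2 * l" using \<open>1 * 2 powi n \<le> l\<close> by auto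
      qed
      have "power_weight p x \<le> 2 * l powr p" if "x \<in> J" for x
      proof -
        have "x powr p \<le> (2 * l) powr p"
          using x[OF that] l assms by (intro powr_mono2) auto
        also have "\<dots> = 2 powr p * l powr p"
          using l by (simp add: powr_mult)
        also have "2 powr p * l powr p \<le> 2 powr 1 * l powr p"
          using assms by (intro mult_right_mono powr_mono) auto
        finally show ?thesis using x[OF that] l by (simp add: power_weight_def)
      qed
      moreover have "power_weight (- p) x \<le> l powr (- p)" if "x \<in> J" for x
        using x[OF that] l assms by (auto simp: power_weight_def intro: powr_mono2')
      ultimately have "avg (power_weight p) J * avg (power_weight (- p)) J \<le> (2 * l powr p) * l powr (- p)"
        by (rule le)
      also have "\<dots> = 2" using l by (simp add: powr_minus)
      finally show ?thesis by simp
    qed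
  qed
  then show "ennreal (avg (power_weight p) J * avg (\<lambda>x. inverse (power_weight p x)) J)
      \<le> ennreal (max 2 (1 / (1 - p)))"
    by (simp only: inverse_power_weight ennreal_leI)
qed

text \<open>On [0, r) the dual average is N r^(-p) and on its left half 2^p times that, so the term
  is (2^p - 1)^2 N^2 r^(1 - p) / (p + 1). For r = 2^(-m) with m < N, the factor r^(1 - p) = 2^(-m /
  N) is at least 1/2, so all N terms are of size N^2.\<close>

lemma square_sum_power_weight:
  fixes N :: nat
  assumes "2 \<le> N"
  defines "p \<equiv> 1 - 1 / real N"
  shows "ennreal (real N ^ 3 / 25) \<le> square_sum (power_weight p) (\<lambda>_. 1) (dyadic_interval 0 0)"
proof -
  have p: "1 / 2 \<le> p" "p < 1" "1 - p = 1 / real N"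
    using assms(1) by (auto simp: p_def field_simps)
  have q: "- 1 < p" "- 1 < - p" using p by auto
  define g where "g I = (abs_mart_diff I (power_weight (- p)))\<^sup>2 * avg (power_weight p) I * measure lebesgue I"
    for I
  define I where "I m = dyadic_interval (- int m) 0" for m
  \<comment> \<open>Keeps 2^p - 1 at least 2/5, as \<open>2 \<le> N\<close> forces p >= 1/2.\<close>
  have "7 / 5 \<le> sqrt 2"
    by (rule real_le_rsqrt) (simp add: power2_eq_square)
  also have "sqrt 2 \<le> 2 powr p"
    unfolding powr_half_sqrt[symmetric, of 2, simplified] using p by (intro powr_mono) auto
  finally have two: "7 / 5 \<le> 2 powr p" .
  have g: "real N ^ 2 / 25 \<le> g (I m)" if "m < N" for m
  proof -
    define r :: real where "r = 2 powi (- int m)"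
    have r: "0 < r" by (simp add: r_def)
    have h: "2 powi (- int m - 1) = r / 2" by (simp add: r_def power_int_diff)
    define s where "s = r powr (- p)"
    have L: "avg (power_weight (- p)) (dyadic_interval (- int m - 1) (2 * 0)) = 2 powr p * s * N"
    proof -
      have "(r / 2) powr (- p) = 2 powr p * s"
        using r by (simp add: s_def powr_divide powr_minus_divide[of 2])
      then show ?thesis
        using p unfolding mult_zero_right avg_power_weight[OF q(2)] h by simp
    qed
    have M: "avg (power_weight (- p)) (I m) = s * N"
      unfolding I_def avg_power_weight[OF q(2)] using p by (simp add: s_def r_def)
    have "avg (power_weight (- p)) (I m) = (avg (power_weight (- p)) (dyadic_interval (- int m - 1) (2 * 0)) +
        avg (power_weight (- p)) (dyadic_interval (- int m - 1) (2 * 0 + 1))) / 2"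
      unfolding I_def
      by (intro avg_dyadic_split locally_integrable_dyadic power_weight_locally_integrable q)
    \<comment> \<open>Half the difference of the children equals the left average minus the parent
      average, so the right half never has to be integrated.\<close>
    then have "abs_mart_diff (I m) (power_weight (- p)) = \<bar>2 powr p * s * N - s * N\<bar>"
    proof -
      let ?R = "avg (power_weight (- p)) (dyadic_interval (- int m - 1) (2 * 0 + 1))"
      assume "avg (power_weight (- p)) (I m) = (avg (power_weight (- p))
        (dyadic_interval (- int m - 1) (2 * 0)) + ?R) / 2"
      then have "2 powr p * s * N - ?R = 2 * (2 powr p * s * N - s * N)"
        unfolding L M by (simp add: field_simps)
      then show ?thesis
        unfolding I_def abs_mart_diff_dyadic L by (simp only: abs_mult) simp
    qed
    also have "\<dots> = \<bar>(2 powr p - 1) * (s * N)\<bar>" by (simp add: algebra_simps)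
    finally have D: "(abs_mart_diff (I m) (power_weight (- p)))\<^sup>2 = (2 powr p - 1)\<^sup>2 * (s * N)\<^sup>2"
      by (simp add: power_mult_distrib)
    have "g (I m) = (2 powr p - 1)\<^sup>2 * (s * N)\<^sup>2 * (r powr p / (p + 1)) * r"
      unfolding g_def D by (simp add: I_def avg_power_weight[OF q(1)] r_def)
    also have "\<dots> = (2 powr p - 1)\<^sup>2 * N\<^sup>2 * ((s * r) * (s * r powr p)) / (p + 1)"
      by (simp add: power2_eq_square)
    also have "s * r powr p = 1"
      using r by (simp add: s_def powr_minus)
    also have "s * r = 2 powr (- (real m / real N))"
    proof -
      have "r = 2 powr (- real m)"
        by (simp add: r_def power_int_minus powr_minus powr_realpow)
      then have "r powr (1 - p) = 2 powr (- (real m / real N))"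
        using p by (simp add: powr_powr)
      moreover have "s * r = r powr (1 - p)"
        using r by (simp add: s_def powr_diff powr_minus field_simps)
      ultimately show ?thesis by simp
    qed
    finally have eq: "g (I m) = (2 powr p - 1)\<^sup>2 * N\<^sup>2 * 2 powr (- (real m / real N)) / (p + 1)"
      by simp
    \<comment> \<open>The constant is (2/5)^2 / 4 = 1/25: one factor 1/2 from 2^(-m / N), the other
      from p + 1 <= 2.\<close>
    have "(2 / 5)\<^sup>2 * N\<^sup>2 * (1 / 2) / 2 \<le> (2 powr p - 1)\<^sup>2 * N\<^sup>2 * 2 powr (- (real m / real N)) / (p + 1)"
    proof (intro frac_le mult_mono power_mono)
      have "2 powr (- 1) \<le> (2::real) powr (- (real m / real N))"
        using that by (intro powr_mono) auto
      then show "1 / 2 \<le> (2::real) powr (- (real m / real N))" by (simp add: powr_minus)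
    qed (use two p in auto)
    then show ?thesis unfolding eq by (simp add: power2_eq_square)
  qed
  have inj: "inj_on I {..<N}"
  proof (rule inj_onI)
    fix a b assume "I a = I b"
    then have "measure lebesgue (I a) = measure lebesgue (I b)" by simp
    then show "a = b" by (simp add: I_def power_int_minus)
  qed
  have sub: "I ` {..<N} \<subseteq> dyadic_subintervals (dyadic_interval 0 0)"
  proof -
    have "(2::real) powi (- int m) \<le> 1" for m
      by (simp add: power_int_minus inverse_le_1_iff)
    then have "I m \<subseteq> dyadic_interval 0 0" for m
      by (auto simp: I_def dyadic_interval_def intro: less_le_trans)
    then show ?thesis by (auto simp: dyadic_subintervals_def dyadic_intervals_def I_def)
  qed
  have "ennreal (real N ^ 3 / 25) = ennreal (\<Sum>m<N. real N ^ 2 / 25)"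
    by (simp add: power3_eq_cube power2_eq_square)
  also have "\<dots> = (\<Sum>m<N. ennreal (real N ^ 2 / 25))"
    by (intro sum_ennreal[symmetric]) simp
  also have "\<dots> \<le> (\<Sum>m<N. ennreal (g (I m)))"
    using g by (intro sum_mono ennreal_leI) auto
  also have "\<dots> = (\<Sum>K\<in>I ` {..<N}. ennreal (g K))"
    by (simp add: sum.reindex[OF inj])
  also have "\<dots> \<le> (\<Sum>\<^sub>\<infinity>K\<in>dyadic_subintervals (dyadic_interval 0 0). ennreal (g K))"
    using sub by (subst nonneg_infsum_complete) (auto intro!: SUP_upper)
  also have "\<dots> = square_sum (power_weight p) (\<lambda>_. 1) (dyadic_interval 0 0)"
    by (simp add: square_sum_def g_def inverse_power_weight)
  finally show ?thesis .
qed

text \<open>For the test weight the right-hand average is N, so an admissible constant is at least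
  N^2 / 25, and N >= Q / 2 turns this into Q^2 / 100.\<close>

lemma C_s_ge:
  assumes "2 \<le> Q"
  shows "ennreal (1 / 100 * Q\<^sup>2) \<le> C_s Q"
  unfolding C_s_def
proof (rule Inf_greatest)
  fix C
  assume "C \<in> {C. \<forall>w J \<phi>. admissible Q w J \<phi> \<longrightarrow>
     square_sum w \<phi> J \<le> C * ennreal (avg (\<lambda>x. (\<phi> x)\<^sup>2 * inverse (w x)) J)}"
  then have C: "\<And>w J \<phi>. admissible Q w J \<phi> \<Longrightarrow>
     square_sum w \<phi> J \<le> C * ennreal (avg (\<lambda>x. (\<phi> x)\<^sup>2 * inverse (w x)) J)" by blast
  \<comment> \<open>Rounding down keeps the characteristic max 2 N within Q.\<close>
  define N where "N = nat \<lfloor>Q\<rfloor>"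
  have N: "2 \<le> N" "real N \<le> Q" "Q / 2 \<le> real N"
    unfolding N_def using assms by linarith+
  define p where "p = 1 - 1 / real N"
  have p: "0 \<le> p" "p < 1" "1 - p = 1 / real N"
    using N by (auto simp: p_def field_simps)
  have q: "- 1 < p" "- 1 < - p" using p by auto
  have "A2_char (power_weight p) \<le> ennreal (max 2 (1 / (1 - p)))"
    by (rule A2_power_weight[OF p(1,2)])
  also have "\<dots> \<le> ennreal Q"
    using p N assms by (intro ennreal_leI) simp
  finally have "admissible Q (power_weight p) (dyadic_interval 0 0) (\<lambda>_. 1)"
    using power_weight_locally_integrable q locally_integrable_dyadic
    by (auto simp: admissible_def weight_def power_weight_pos inverse_power_weight dyadic_intervals_def)
  from C[OF this] have "square_sum (power_weight p) (\<lambda>_. 1) (dyadic_interval 0 0) \<le> C * ennreal (real N)"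
    using avg_power_weight[OF q(2), of 0] p by (simp add: inverse_power_weight)
  with square_sum_power_weight[OF N(1)] have *: "ennreal (real N ^ 3 / 25) \<le> C * ennreal (real N)"
    unfolding p_def by (rule order_trans)
  show "ennreal (1 / 100 * Q\<^sup>2) \<le> C"
  proof (cases C)
    case (real c)
    then have "real N ^ 3 / 25 \<le> c * real N"
      using * by (simp add: ennreal_mult'[symmetric])
    then have "(real N)\<^sup>2 / 25 \<le> c"
      using N by (simp add: power3_eq_cube power2_eq_square field_simps)
    moreover have "(Q / 2)\<^sup>2 \<le> (real N)\<^sup>2"
      using N assms by (intro power_mono) auto
    ultimately have "1 / 100 * Q\<^sup>2 \<le> c" by (simp add: power_divide)
    then show ?thesis using real by (simp add: ennreal_leI)
  qed simp
qed

theorem theorem2p2: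
  shows "(\<exists>A::real. 0 \<le> A \<and> (\<forall>Q\<ge>1.
            C_s Q \<le> ennreal (A * Q\<^sup>2) \<and>
            (\<forall>w J \<phi>. weight w \<and> A2_char w \<le> ennreal Q \<and> J \<in> dyadic_intervals \<and>
               \<phi> \<in> borel_measurable lebesgue \<and>
               set_integrable lebesgue J (\<lambda>x. (\<phi> x)\<^sup>2 * inverse (w x)) \<longrightarrow>
               square_sum w \<phi> J
                 \<le> ennreal (A * Q\<^sup>2 * avg (\<lambda>x. (\<phi> x)\<^sup>2 * inverse (w x)) J))))
       \<and> (\<exists>c::real. 0 < c \<and> (\<forall>\<^sub>F Q in at_top. ennreal (c * Q\<^sup>2) \<le> C_s Q))"
proof (intro conjI)
  show "\<exists>c::real. 0 < c \<and> (\<forall>\<^sub>F Q in at_top. ennreal (c * Q\<^sup>2) \<le> C_s Q)"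
    using C_s_ge by (intro exI[of _ "1 / 100"] conjI eventually_at_top_linorderI[of 2]) auto
qed (use C_s_le square_sum_le in \<open>intro exI[of _ 72] conjI allI impI; simp\<close>)

end
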